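(* Let $m\ge 1$ be an integer, let $t_j=\cos\frac{2j\pi}{2m+1}$ for $j=1,2,\ldots,m$, and put $\mathbf t=\{t_1,\ldots,t_m\}$. For $1\le j\le m-1$ let $X_j(t)\in\mathbb R^{m}$ be the column vector with entries $$U_{2m-2}(t),U_{2m-4}(t),\ldots,U_{2j}(t),\;U_{2m-1}(t),U_{2m-3}(t),\ldots,U_{2m-2j+1}(t),$$ let $X_m(t)\in\mathbb R^m$ be the column vector with entries $U_{2m-1}(t),U_{2m-3}(t),\ldots,U_3(t),U_1(t)$, and for $1\le j\le m$ let $\Xi_j(\mathbf t)=[X_j(t_1),\ldots,X_j(t_m)]$. Then the $m\times m$ matrices $\Xi_1(\mathbf t),\Xi_2(\mathbf t),\ldots,\Xi_m(\mathbf t)$ are all nonsingular. Consequently, every polynomial $P\in\Pi_{2m-1}^2$ is uniquely determined by the set of its Radon projections $$\mathcal R_{\phi_{j,m}}(P;t_k),\qquad 0\le j\le 2m,\quad 1\le k\le m,\qquad \phi_{j,m}=\frac{2j\pi}{2m+1};$$ that is, if $P,Q\in\Pi_{2m-1}^2$ satisfy $\mathcal R_{\phi_{j,m}}(P;t_k)=\mathcal R_{\phi_{j,m}}(Q;t_k)$ for all $0\le j\le 2m$ and $1\le k\le m$, then $P=Q$.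
   Context: $\Pi_n^2$ is the space of real polynomials in two variables of total degree at most $n$. The Radon projection of a function $f$ on the closed unit disk in direction $\theta$ with parameter $t\in[-1,1]$ is $$\mathcal R_\theta(f;t)=\int_{-\sqrt{1-t^2}}^{\sqrt{1-t^2}} f(t\cos\theta-s\sin\theta,\;t\sin\theta+s\cos\theta)\,ds .$$ $U_k$ is the Chebyshev polynomial of the second kind, $U_k(\cos\theta)=\sin((k+1)\theta)/\sin\theta$. *)

theory Defs
  imports
    "HOL-Analysis.Analysis"
    "HOL-Computational_Algebra.Polynomial"
    "Jordan_Normal_Form.Matrix"
begin

text \<open>
  Polynomials in two variables of total degree at most \<open>n\<close>, as functions on the plane. Since
  the reals are an infinite field, equality of such functions is equality of polynomials.
\<close>
definition poly2_space :: "nat \<Rightarrow> (real \<times> real \<Rightarrow> real) set" where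
  "poly2_space n =
     {f. \<exists>c :: nat \<Rightarrow> nat \<Rightarrow> real.
           f = (\<lambda>(x, y). \<Sum>i\<le>n. \<Sum>j\<le>n - i. c i j * x ^ i * y ^ j)}"

definition radon :: "real \<Rightarrow> (real \<times> real \<Rightarrow> real) \<Rightarrow> real \<Rightarrow> real" where
  "radon \<theta> f t =
     integral {- sqrt (1 - t\<^sup>2) .. sqrt (1 - t\<^sup>2)}
       (\<lambda>s. f (t * cos \<theta> - s * sin \<theta>, t * sin \<theta> + s * cos \<theta>))"

text \<open>
  The Chebyshev polynomial of the second kind; that the description has exactly one solution is
  shown below.
\<close>
definition chebyshev_U :: "nat \<Rightarrow> real poly" where
  "chebyshev_U k =
     (THE p. \<forall>\<theta>. sin \<theta> \<noteq> 0 \<longrightarrow> poly p (cos \<theta>) = sin (real (k + 1) * \<theta>) / sin \<theta>)"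

lemma chebyshev_U_exists:
  "\<exists>p :: real poly. \<forall>\<theta>. sin \<theta> \<noteq> 0 \<longrightarrow> poly p (cos \<theta>) = sin (real (k + 1) * \<theta>) / sin \<theta>"
proof (induction k rule: induct_nat_012)
  case 0
  show ?case by (rule exI[of _ 1]) simp
next
  case 1
  show ?case by (rule exI[of _ "[:0, 2:]"]) (simp add: sin_double)
next
  case (ge2 k)
  then obtain p q :: "real poly"
    where p: "\<forall>\<theta>. sin \<theta> \<noteq> 0 \<longrightarrow> poly p (cos \<theta>) = sin (real (k + 1) * \<theta>) / sin \<theta>"
      and q: "\<forall>\<theta>. sin \<theta> \<noteq> 0 \<longrightarrow> poly q (cos \<theta>) = sin (real (Suc k + 1) * \<theta>) / sin \<theta>"
    by blast
  have rec: "sin (real (Suc (Suc k) + 1) * \<theta>)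
      = 2 * cos \<theta> * sin (real (Suc k + 1) * \<theta>) - sin (real (k + 1) * \<theta>)" for \<theta> :: real
  proof -
    have 1: "real (Suc (Suc k) + 1) * \<theta> = real (Suc k + 1) * \<theta> + \<theta>"
      and 2: "real (k + 1) * \<theta> = real (Suc k + 1) * \<theta> - \<theta>"
      by (simp_all add: algebra_simps)
    show ?thesis unfolding 1 2 by (simp only: sin_add sin_diff) simp
  qed
  show ?case
  proof (intro exI allI impI)
    fix \<theta> :: real
    assume s: "sin \<theta> \<noteq> 0"
    have "poly ([:0, 2:] * q - p) (cos \<theta>)
        = 2 * cos \<theta> * (sin (real (Suc k + 1) * \<theta>) / sin \<theta>) - sin (real (k + 1) * \<theta>) / sin \<theta>"
      using p q s by simp
    also have "\<dots> = sin (real (Suc (Suc k) + 1) * \<theta>) / sin \<theta>"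
      unfolding rec using s by (simp add: diff_divide_distrib)
    finally show "poly ([:0, 2:] * q - p) (cos \<theta>) = sin (real (Suc (Suc k) + 1) * \<theta>) / sin \<theta>" .
  qed
qed

lemma poly_eq_if_eq_on_cos:
  fixes p q :: "real poly"
  assumes "\<And>\<theta>. sin \<theta> \<noteq> 0 \<Longrightarrow> poly p (cos \<theta>) = poly q (cos \<theta>)"
  shows "p = q"
proof -
  have "poly (p - q) x = 0" if "x \<in> {-1<..<1}" for x :: real
  proof -
    have "sin (arccos x) \<noteq> 0"
      using that by (simp add: sin_arccos_nonzero)
    then show ?thesis
      using assms[of "arccos x"] that by simp
  qed
  then have "{-1<..<1} \<subseteq> {x. poly (p - q) x = 0}" by blast
  moreover have "infinite {-1<..<1 :: real}" by (rule infinite_Ioo) simp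
  ultimately have "infinite {x. poly (p - q) x = 0}" using finite_subset by blast
  then show "p = q" using poly_roots_finite[of "p - q"] by fastforce
qed

lemma poly_chebyshev_U_cos:
  assumes "sin \<theta> \<noteq> 0"
  shows "poly (chebyshev_U k) (cos \<theta>) = sin (real (k + 1) * \<theta>) / sin \<theta>"
proof -
  have "\<exists>!p :: real poly.
      \<forall>\<theta>. sin \<theta> \<noteq> 0 \<longrightarrow> poly p (cos \<theta>) = sin (real (k + 1) * \<theta>) / sin \<theta>"
    using chebyshev_U_exists[of k] by (auto intro!: poly_eq_if_eq_on_cos)
  from theI'[OF this] show ?thesis
    using assms unfolding chebyshev_U_def by blast
qed

definition node :: "nat \<Rightarrow> nat \<Rightarrow> real" where
  "node m j = cos (2 * real j * pi / (2 * real m + 1))"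

definition direction :: "nat \<Rightarrow> nat \<Rightarrow> real" where
  "direction j m = 2 * real j * pi / (2 * real m + 1)"

text \<open>
  The degrees of the Chebyshev polynomials in \<open>X\<^sub>j\<close>, from top to bottom:
  \<open>2m - 2, 2m - 4, \<dots>, 2j, 2m - 1, 2m - 3, \<dots>, 2m - 2j + 1\<close> for \<open>j < m\<close>
  and \<open>2m - 1, 2m - 3, \<dots>, 3, 1\<close> for \<open>j = m\<close>.
\<close>
definition X_degrees :: "nat \<Rightarrow> nat \<Rightarrow> nat list" where
  "X_degrees m j =
     (if j < m
      then map (\<lambda>i. 2 * i) (rev [j..<m]) @ map (\<lambda>i. 2 * i + 1) (rev [m - j..<m])
      else map (\<lambda>i. 2 * i + 1) (rev [0..<m]))"

definition X :: "nat \<Rightarrow> nat \<Rightarrow> real \<Rightarrow> real vec" where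
  "X m j t = vec_of_list (map (\<lambda>k. poly (chebyshev_U k) t) (X_degrees m j))"

definition Xi :: "nat \<Rightarrow> nat \<Rightarrow> (nat \<Rightarrow> real) \<Rightarrow> real mat" where
  "Xi m j t = mat_of_cols m (map (\<lambda>k. X m j (t k)) [1..<m + 1])"

lemma X_carrier: "X m j t \<in> carrier_vec m"
  by (intro carrier_vecI) (simp add: X_def X_degrees_def)

lemma Xi_carrier: "Xi m j t \<in> carrier_mat m m"
  by (rule carrier_matI) (simp_all add: Xi_def del: upt_Suc)

end

theory Submission
  imports Defs "Jordan_Normal_Form.Determinant"
begin

text \<open>
  At the nodes, \<open>U\<^bsub>2m-1-d\<^esub> = - U\<^sub>d\<close>, and \<open>U\<^sub>0, \<dots>, U\<^bsub>m-1\<^esub>\<close> are linearly independent on the \<open>m\<close>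
  nodes. Hence the only linear relations among \<open>U\<^sub>0, \<dots>, U\<^bsub>2m-1\<^esub>\<close> at the nodes are those with
  \<open>c\<^sub>d = c\<^bsub>2m-1-d\<^esub>\<close>. The degrees in \<open>X\<^sub>j\<close> contain exactly one of \<open>d\<close> and \<open>2m - 1 - d\<close>, so
  \<open>\<Xi>\<^sub>j\<close> is nonsingular.

  For the uniqueness, expand polynomials in the ridge functions
  \<open>U\<^sub>k (x cos \<eta> + y sin \<eta>)\<close> with \<open>k + 1\<close> equispaced angles \<open>\<eta>\<close> for each \<open>k\<close>. The Radon projection
  of such a ridge function at \<open>t = cos \<psi>\<close> in direction \<open>\<theta>\<close> is
  \<open>2 / (k + 1) sin \<psi> U\<^sub>k (t) U\<^sub>k (cos (\<theta> - \<eta>))\<close>. If the data vanish, the coefficient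
  \<open>A\<^sub>d (\<theta>)\<close> of \<open>U\<^sub>d (t)\<close> therefore equals \<open>A\<^bsub>2m-1-d\<^esub> (\<theta>)\<close> in all \<open>2m + 1\<close> directions. The
  frequencies \<open>-d, -d + 2, \<dots>, d\<close> of \<open>A\<^sub>d\<close> together with those of \<open>A\<^bsub>2m-1-d\<^esub>\<close> are distinct modulo
  \<open>2m + 1\<close>, so both vanish identically, and evaluating \<open>A\<^sub>d\<close> at the angles \<open>\<eta>\<close> recovers the
  expansion coefficients.
\<close>

subsection \<open>Chebyshev polynomials at the nodes\<close>

text \<open>Unlike the defining quotient, this form also covers integer multiples of pi, where both
  sides vanish.\<close>

lemma chebyshev_U_cos_mult_sin:
  "poly (chebyshev_U k) (cos \<theta>) * sin \<theta> = sin (real (k + 1) * \<theta>)"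
proof (cases "sin \<theta> = 0")
  case True
  then obtain i :: int where "\<theta> = of_int i * pi"
    by (auto simp: sin_zero_iff_int2)
  then have "real (k + 1) * \<theta> = of_int (int (k + 1) * i) * pi"
    by simp
  then have "sin (real (k + 1) * \<theta>) = 0"
    unfolding sin_zero_iff_int2 by blast
  then show ?thesis using True by simp
next
  case False
  then show ?thesis by (simp add: poly_chebyshev_U_cos)
qed

lemma chebyshev_U_0 [simp]: "chebyshev_U 0 = 1"
  by (rule poly_eq_if_eq_on_cos) (simp add: poly_chebyshev_U_cos)

lemma chebyshev_U_Suc_0 [simp]: "chebyshev_U (Suc 0) = [:0, 2:]"
  by (rule poly_eq_if_eq_on_cos) (simp add: poly_chebyshev_U_cos sin_double)

lemma chebyshev_U_rec:
  "chebyshev_U (Suc (Suc k)) = [:0, 2:] * chebyshev_U (Suc k) - chebyshev_U k"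
proof (rule poly_eq_if_eq_on_cos)
  fix \<theta> :: real
  assume s: "sin \<theta> \<noteq> 0"
  have 1: "real (Suc (Suc k) + 1) * \<theta> = real (Suc k + 1) * \<theta> + \<theta>"
    and 2: "real (k + 1) * \<theta> = real (Suc k + 1) * \<theta> - \<theta>"
    by (simp_all add: algebra_simps)
  have "sin (real (Suc (Suc k) + 1) * \<theta>)
      = 2 * cos \<theta> * sin (real (Suc k + 1) * \<theta>) - sin (real (k + 1) * \<theta>)"
    unfolding 1 2 by (simp only: sin_add sin_diff) simp
  then show "poly (chebyshev_U (Suc (Suc k))) (cos \<theta>)
      = poly ([:0, 2:] * chebyshev_U (Suc k) - chebyshev_U k) (cos \<theta>)"
    using s by (simp add: poly_chebyshev_U_cos diff_divide_distrib del: of_nat_Suc)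
qed

lemma degree_chebyshev_U_le: "degree (chebyshev_U k) \<le> k"
proof (induction k rule: induct_nat_012)
  case (ge2 k)
  have "degree ([:0, 2:] * chebyshev_U (Suc k)) \<le> Suc (Suc k)"
    using degree_mult_le[of "[:0, 2 :: real:]" "chebyshev_U (Suc k)"] ge2 by simp
  then show ?case
    unfolding chebyshev_U_rec using ge2 by (intro degree_diff_le) auto
qed simp_all

lemma coeff_chebyshev_U_top: "coeff (chebyshev_U k) k = 2 ^ k"
proof (induction k rule: induct_nat_012)
  case (ge2 k)
  have "coeff (chebyshev_U k) (Suc (Suc k)) = 0"
    using degree_chebyshev_U_le[of k] by (intro coeff_eq_0) simp
  then show ?case
    unfolding chebyshev_U_rec using ge2 by simp
qed simp_all

text \<open>Covers the arguments 1 and -1, where the quotient of sines is 0/0. Up to the factor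
  \<open>cos \<alpha>\<close>, the right side is the limit of that quotient; keeping the factor
  treats both signs at once.\<close>

lemma chebyshev_U_cos_if_sin_eq_0:
  assumes "sin \<alpha> = 0"
  shows "poly (chebyshev_U k) (cos \<alpha>) * cos \<alpha> = real (k + 1) * cos (real (k + 1) * \<alpha>)"
proof (induction k rule: induct_nat_012)
  case 1
  show ?case
    using assms sin_cos_squared_add[of \<alpha>]
    by (simp add: cos_double power2_eq_square)
next
  case (ge2 k)
  have c2: "cos \<alpha> * cos \<alpha> = 1"
    using assms sin_cos_squared_add[of \<alpha>] by (simp add: power2_eq_square)
  have 1: "real (Suc (Suc k) + 1) * \<alpha> = real (Suc k + 1) * \<alpha> + \<alpha>"
    and 2: "real (Suc k + 1) * \<alpha> = real (k + 1) * \<alpha> + \<alpha>"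
    by (simp_all add: algebra_simps)
  have e1: "cos (real (Suc k + 1) * \<alpha>) = cos (real (k + 1) * \<alpha>) * cos \<alpha>"
    unfolding 2 using assms by (simp add: cos_add)
  have e2: "cos (real (Suc (Suc k) + 1) * \<alpha>) = cos (real (k + 1) * \<alpha>)"
    unfolding 1 cos_add e1 using assms c2 by (simp add: mult.assoc)
  have "poly (chebyshev_U (Suc (Suc k))) (cos \<alpha>) * cos \<alpha>
      = 2 * cos \<alpha> * (poly (chebyshev_U (Suc k)) (cos \<alpha>) * cos \<alpha>)
        - poly (chebyshev_U k) (cos \<alpha>) * cos \<alpha>"
    unfolding chebyshev_U_rec by (simp add: algebra_simps)
  also have "\<dots> = 2 * real (Suc k + 1) * cos (real (k + 1) * \<alpha>) * (cos \<alpha> * cos \<alpha>)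
      - real (k + 1) * cos (real (k + 1) * \<alpha>)"
    unfolding ge2 e1 by (simp add: algebra_simps)
  finally show ?case
    unfolding c2 e2 by (simp add: algebra_simps)
qed simp

lemma two_cos_mult_cis: "complex_of_real (2 * cos \<alpha>) * cis \<alpha> = 1 + cis (2 * \<alpha>)"
  by (simp add: complex_eq_iff cos_double_cos sin_double power2_eq_square)

text \<open>\<open>U_k\<close> has the frequencies -k, -k + 2, ..., k, each with coefficient 1. The
  factor \<open>cis \<alpha> ^ k\<close> shifts them to 0, 2, ..., 2k, which leaves a polynomial in
  \<open>cis (2 * \<alpha>)\<close>.\<close>

lemma chebyshev_U_cis:
  "complex_of_real (poly (chebyshev_U k) (cos \<alpha>)) * cis \<alpha> ^ k = (\<Sum>l\<le>k. cis (2 * \<alpha>) ^ l)"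
proof (induction k rule: induct_nat_012)
  case 1
  show ?case using two_cos_mult_cis[of \<alpha>] by (simp add: mult.commute)
next
  case (ge2 k)
  have sq: "cis \<alpha> * cis \<alpha> = cis (2 * \<alpha>)"
    by (simp add: cis_mult)
  have "complex_of_real (poly (chebyshev_U (Suc (Suc k))) (cos \<alpha>)) * cis \<alpha> ^ Suc (Suc k)
      = (complex_of_real (2 * cos \<alpha>) * cis \<alpha>)
          * (complex_of_real (poly (chebyshev_U (Suc k)) (cos \<alpha>)) * cis \<alpha> ^ Suc k)
        - (cis \<alpha> * cis \<alpha>) * (complex_of_real (poly (chebyshev_U k) (cos \<alpha>)) * cis \<alpha> ^ k)"
    unfolding chebyshev_U_rec by (simp add: algebra_simps)
  also have "\<dots> = (1 + cis (2 * \<alpha>)) * (\<Sum>l\<le>Suc k. cis (2 * \<alpha>) ^ l)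
      - cis (2 * \<alpha>) * (\<Sum>l\<le>k. cis (2 * \<alpha>) ^ l)"
    unfolding two_cos_mult_cis sq ge2 ..
  also have "\<dots> = (\<Sum>l\<le>Suc (Suc k). cis (2 * \<alpha>) ^ l)"
    by (simp add: algebra_simps)
  finally show ?case .
qed simp

text \<open>The top coefficient of the summand of highest degree cannot be cancelled by the others,
  so the coefficients vanish from the top down.\<close>

lemma chebyshev_U_sum_eq_0:
  assumes "(\<Sum>d<n. Polynomial.smult (b d) (chebyshev_U d)) = 0" and "d < n"
  shows "b d = 0"
  using assms
proof (induction n)
  case (Suc n)
  have low: "coeff (chebyshev_U e) n = 0" if "e < n" for e
    using that degree_chebyshev_U_le[of e] by (simp add: coeff_eq_0)
  have "coeff (\<Sum>d<Suc n. Polynomial.smult (b d) (chebyshev_U d)) n = b n * 2 ^ n"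
    by (simp add: coeff_sum low coeff_chebyshev_U_top)
  with Suc.prems(1) have "b n = 0" by simp
  with Suc show ?case by (cases "d = n") auto
qed simp

lemma node_eq_cos: "node m j = cos (direction j m)"
  by (simp add: node_def direction_def)

lemma direction_in_0_pi:
  assumes "k \<in> {1..m}"
  shows "0 < direction k m" and "direction k m < pi"
proof -
  have "2 * real k < 2 * real m + 1" using assms by auto
  then have "pi * (2 * real k) < pi * (2 * real m + 1)"
    by (simp only: mult_less_cancel_left_pos pi_gt_zero)
  then show "direction k m < pi"
    by (simp add: direction_def field_simps)
qed (use assms in \<open>simp add: direction_def\<close>)

lemma inj_on_node: "inj_on (node m) {1..m}"
proof (rule inj_onI)
  fix j k
  assume jk: "j \<in> {1..m}" "k \<in> {1..m}" and "node m j = node m k"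
  then have "direction j m = direction k m"
    using direction_in_0_pi[OF jk(1)] direction_in_0_pi[OF jk(2)]
    by (simp add: node_eq_cos cos_inj_pi)
  moreover have "2 * real m + 1 \<noteq> 0" "pi \<noteq> 0" by simp_all
  ultimately show "j = k"
    unfolding direction_def divide_cancel_right mult_cancel_right by simp
qed

text \<open>The angle of a node times \<open>2 * m + 1\<close> is a multiple of 2 pi, so the sines
  of \<open>2 * m - d\<close> times and \<open>d + 1\<close> times this angle are opposite.\<close>

lemma chebyshev_U_node_reflect:
  assumes "k \<in> {1..m}" and "d < 2 * m"
  shows "poly (chebyshev_U (2 * m - 1 - d)) (node m k) = - poly (chebyshev_U d) (node m k)"
proof -
  let ?\<theta> = "direction k m"
  have s: "sin ?\<theta> \<noteq> 0"
    using direction_in_0_pi[OF assms(1)] sin_gt_zero by force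
  have "real (2 * m - 1 - d + 1) = 2 * real m + 1 - real (d + 1)"
    using assms(2) by (simp add: of_nat_diff)
  then have "real (2 * m - 1 - d + 1) * ?\<theta> = (2 * real m + 1) * ?\<theta> - real (d + 1) * ?\<theta>"
    by (simp only: left_diff_distrib)
  also have "(2 * real m + 1) * ?\<theta> = 2 * real k * pi"
    by (simp add: direction_def field_simps)
  finally have "sin (real (2 * m - 1 - d + 1) * ?\<theta>) = - sin (real (d + 1) * ?\<theta>)"
    by (simp add: sin_diff sin_2npi cos_2npi del: of_nat_Suc)
  then show ?thesis
    unfolding node_eq_cos poly_chebyshev_U_cos[OF s] by (simp del: of_nat_Suc)
qed

text \<open>After folding \<open>d\<close> with \<open>2m - 1 - d\<close>, a polynomial of degree below \<open>m\<close> has \<open>m\<close> roots.\<close>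
lemma chebyshev_U_node_kernel:
  assumes zero: "\<And>k. k \<in> {1..m} \<Longrightarrow> (\<Sum>d<2 * m. c d * poly (chebyshev_U d) (node m k)) = 0"
    and d: "d < 2 * m"
  shows "c d = c (2 * m - 1 - d)"
proof -
  define b where "b d = c d - c (2 * m - 1 - d)" for d
  define q where "q = (\<Sum>d<m. Polynomial.smult (b d) (chebyshev_U d))"
  have root: "poly q (node m k) = 0" if k: "k \<in> {1..m}" for k
  proof -
    let ?U = "\<lambda>d. poly (chebyshev_U d) (node m k)"
    have "{..<2 * m} = {..<m} \<union> {m..<2 * m}" by auto
    then have "(\<Sum>d<2 * m. c d * ?U d) = (\<Sum>d<m. c d * ?U d) + (\<Sum>d\<in>{m..<2 * m}. c d * ?U d)"
      by (simp add: sum.union_disjoint ivl_disj_int)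
    also have "(\<Sum>d\<in>{m..<2 * m}. c d * ?U d)
        = (\<Sum>d<m. c (2 * m - 1 - d) * ?U (2 * m - 1 - d))"
      by (rule sum.reindex_bij_witness[of _ "\<lambda>d. 2 * m - 1 - d" "\<lambda>d. 2 * m - 1 - d"]) auto
    also have "\<dots> = (\<Sum>d<m. c (2 * m - 1 - d) * - ?U d)"
      by (intro sum.cong refl) (subst chebyshev_U_node_reflect[OF k], auto)
    finally show ?thesis
      using zero[OF k]
      by (simp add: q_def b_def poly_sum left_diff_distrib sum_subtractf sum_negf del: One_nat_def)
  qed
  have "q = 0"
  proof (rule ccontr)
    assume nz: "q \<noteq> 0"
    then have "m > 0" by (cases m) (auto simp: q_def)
    have "degree q \<le> m - 1"
      unfolding q_def
    proof (intro degree_sum_le)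
      fix d assume "d \<in> {..<m}"
      then show "degree (Polynomial.smult (b d) (chebyshev_U d)) \<le> m - 1"
        using degree_chebyshev_U_le[of d] by (auto intro: order.trans[OF degree_smult_le])
    qed simp
    moreover have "card (node m ` {1..m}) \<le> card {x. poly q x = 0}"
      using root nz by (intro card_mono poly_roots_finite) auto
    moreover have "card {x. poly q x = 0} \<le> degree q"
      using nz by (rule card_poly_roots_bound)
    ultimately show False
      using \<open>m > 0\<close> using card_image[OF inj_on_node[of m]] by simp
  qed
  then have b0: "b e = 0" if "e < m" for e
    using chebyshev_U_sum_eq_0[of b m e] that by (simp add: q_def)
  show ?thesis
  proof (cases "d < m")
    case True
    then show ?thesis using b0 by (simp add: b_def)
  next
    \<comment> \<open>The reflected degree lies below \<open>m\<close> and gives the same equation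
      with its sides exchanged.\<close>
    case False
    then show ?thesis using b0[of "2 * m - 1 - d"] d by (simp add: b_def)
  qed
qed

subsection \<open>Nonsingularity of \<open>\<Xi>\<^sub>j\<close>\<close>

text \<open>Even degrees start at \<open>2 * j\<close>, odd ones at \<open>2 * (m - j) + 1\<close>.
  Reflection swaps parities and sends the even ones below \<open>2 * (m - j)\<close>, so no
  reflected pair lies in the list.\<close>

lemma X_degrees_complementary:
  assumes "j \<in> {1..m}"
  shows "length (X_degrees m j) = m" and "distinct (X_degrees m j)"
    and "set (X_degrees m j) \<subseteq> {..<2 * m}"
    and "d \<in> set (X_degrees m j) \<Longrightarrow> 2 * m - 1 - d \<notin> set (X_degrees m j)"
proof -
  show "length (X_degrees m j) = m"
    using assms by (auto simp: X_degrees_def)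
  show "distinct (X_degrees m j)"
    by (auto simp: X_degrees_def distinct_map inj_on_def) presburger
  have set_eq: "set (X_degrees m j) =
      (if j < m then (\<lambda>i. 2 * i) ` {j..<m} \<union> (\<lambda>i. 2 * i + 1) ` {m - j..<m}
       else (\<lambda>i. 2 * i + 1) ` {0..<m})"
    by (simp add: X_degrees_def)
  show "set (X_degrees m j) \<subseteq> {..<2 * m}"
    unfolding set_eq by auto
  have bounds: "e < 2 * m" "even e \<Longrightarrow> 2 * j \<le> e" "odd e \<Longrightarrow> 2 * (m - j) < e"
    if "e \<in> set (X_degrees m j)" for e
    using that assms unfolding set_eq by (auto split: if_splits)
  show "2 * m - 1 - d \<notin> set (X_degrees m j)" if d: "d \<in> set (X_degrees m j)"
  proof
    assume d': "2 * m - 1 - d \<in> set (X_degrees m j)"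
    show False
    proof (cases "even d")
      case True
      then have "odd (2 * m - 1 - d)" using bounds(1)[OF d] by simp
      then show False using bounds(2)[OF d True] bounds(3)[OF d'] assms by auto
    next
      case False
      then have "even (2 * m - 1 - d)" using bounds(1)[OF d] by simp
      then show False using bounds(3)[OF d False] bounds(2)[OF d'] assms by auto
    qed
  qed
qed

lemma X_index:
  assumes "a < length (X_degrees m j)"
  shows "X m j t $ a = poly (chebyshev_U (X_degrees m j ! a)) t"
  using assms by (simp add: X_def vec_of_list_index)

text \<open>Each row of \<open>Xi\<close> samples one Chebyshev polynomial at all nodes. A linear
  relation among these rows is a kernel vector of the transpose, hence this form of the
  criterion.\<close>

lemma invertible_mat_if_transpose_kernel:
  fixes A :: "'a :: field mat"
  assumes A: "A \<in> carrier_mat n n"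
    and ker: "\<And>v. v \<in> carrier_vec n \<Longrightarrow> transpose_mat A *\<^sub>v v = 0\<^sub>v n \<Longrightarrow> v = 0\<^sub>v n"
  shows "invertible_mat A"
proof -
  have "det (transpose_mat A) \<noteq> 0"
    using det_0_iff_vec_prod_zero[of "transpose_mat A" n] A ker by auto
  then have "det A \<noteq> 0" using A by (simp add: det_transpose)
  \<comment> \<open>\<open>undefined\<close> fills the extension field of the matrix ring record;
    any value would do.\<close>
  from det_non_zero_imp_unit[OF A this, of undefined]
  obtain B where "B \<in> carrier_mat n n" "B * A = 1\<^sub>m n" "A * B = 1\<^sub>m n"
    by (auto simp: Units_def ring_mat_simps)
  with A show ?thesis
    unfolding invertible_mat_def inverts_mat_def by auto
qed

lemma invertible_Xi:
  assumes j: "j \<in> {1..m}"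
  shows "invertible_mat (Xi m j (node m))"
proof (rule invertible_mat_if_transpose_kernel[OF Xi_carrier])
  fix v :: "real vec"
  assume v: "v \<in> carrier_vec m"
    and ker: "transpose_mat (Xi m j (node m)) *\<^sub>v v = 0\<^sub>v m"
  let ?D = "X_degrees m j"
  note D = X_degrees_complementary[OF j]
  \<comment> \<open>Extends \<open>v\<close> to a coefficient for every degree, zero off the list,
    so that \<open>chebyshev_U_node_kernel\<close> applies.\<close>
  define c where "c d = (\<Sum>a<m. if ?D ! a = d then v $ a else 0)" for d
  have c_nth: "c (?D ! a) = v $ a" if "a < m" for a
  proof -
    have "c (?D ! a) = (\<Sum>b<m. if b = a then v $ b else 0)"
      unfolding c_def using D(1,2) that by (intro sum.cong) (auto simp: nth_eq_iff_index_eq)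
    then show ?thesis using that by simp
  qed
  have c_notin: "c d = 0" if "d \<notin> set ?D" for d
    unfolding c_def using that D(1) by (intro sum.neutral) auto
  have zero: "(\<Sum>d<2 * m. c d * poly (chebyshev_U d) (node m k)) = 0" if k: "k \<in> {1..m}" for k
  proof -
    let ?U = "\<lambda>d. poly (chebyshev_U d) (node m k)"
    have "(\<Sum>d<2 * m. c d * ?U d) = (\<Sum>d<2 * m. \<Sum>a<m. if ?D ! a = d then v $ a * ?U d else 0)"
      unfolding c_def sum_distrib_right by (intro sum.cong) auto
    also have "\<dots> = (\<Sum>a<m. \<Sum>d<2 * m. if ?D ! a = d then v $ a * ?U d else 0)"
      by (rule sum.swap)
    also have "\<dots> = (\<Sum>a<m. v $ a * ?U (?D ! a))"
    proof (intro sum.cong refl)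
      fix a assume "a \<in> {..<m}"
      then have "?D ! a \<in> set ?D" using D(1) by simp
      then have "?D ! a < 2 * m" using D(3) by blast
      then show "(\<Sum>d<2 * m. if ?D ! a = d then v $ a * ?U d else 0) = v $ a * ?U (?D ! a)"
        by simp
    qed
    \<comment> \<open>Nodes are counted from 1, columns from 0.\<close>
    also have "\<dots> = (transpose_mat (Xi m j (node m)) *\<^sub>v v) $ (k - 1)"
    proof -
      have "col (Xi m j (node m)) (k - 1) = X m j (node m k)"
        using k X_carrier[of m j] unfolding Xi_def
        by (subst col_mat_of_cols) (auto simp del: upt_Suc)
      moreover have "k - 1 < m" using k by auto
      ultimately show ?thesis
        using v D(1) Xi_carrier[of m j "node m"]
        by (simp add: scalar_prod_def X_index atLeast0LessThan mult.commute)
    qed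
    also have "\<dots> = 0" unfolding ker using k by auto
    finally show ?thesis .
  qed
  have "v $ a = 0" if a: "a < m" for a
  proof -
    have mem: "?D ! a \<in> set ?D" using a D(1) by simp
    then have "?D ! a < 2 * m" using D(3) by blast
    then have "c (?D ! a) = c (2 * m - 1 - ?D ! a)"
      using chebyshev_U_node_kernel[of m c "?D ! a"] zero by blast
    also have "\<dots> = 0" using D(4)[OF mem] by (rule c_notin)
    finally show ?thesis using c_nth[OF a] by simp
  qed
  then show "v = 0\<^sub>v m" using v by (intro eq_vecI) auto
qed

subsection \<open>Radon projections of ridge functions\<close>

text \<open>\<open>T\<close> is the Chebyshev polynomial of the first kind of degree
  \<open>k + 1\<close>; its derivative comes from differentiating
  \<open>cos (real (k + 1) * \<theta>)\<close> in two ways.\<close>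

lemma chebyshev_U_antiderivative:
  obtains T :: "real poly" where "\<And>\<theta>. poly T (cos \<theta>) = cos (real (k + 1) * \<theta>)"
    and "pderiv T = Polynomial.smult (real (k + 1)) (chebyshev_U k)"
proof -
  have "\<exists>T :: real poly. \<forall>\<theta>. poly T (cos \<theta>) = cos (real n * \<theta>)" for n
  proof (induction n rule: induct_nat_012)
    case 0
    show ?case by (rule exI[of _ 1]) simp
  next
    case 1
    show ?case by (rule exI[of _ "[:0, 1:]"]) simp
  next
    case (ge2 n)
    then obtain p q :: "real poly" where
      pq: "\<And>\<theta>. poly p (cos \<theta>) = cos (real n * \<theta>)"
        "\<And>\<theta>. poly q (cos \<theta>) = cos (real (Suc n) * \<theta>)"
      by blast
    show ?case
    proof (intro exI allI)
      fix \<theta> :: real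
      have 1: "real (Suc (Suc n)) * \<theta> = real (Suc n) * \<theta> + \<theta>"
        and 2: "real n * \<theta> = real (Suc n) * \<theta> - \<theta>"
        by (simp_all add: algebra_simps)
      have "poly ([:0, 2:] * q - p) (cos \<theta>)
          = 2 * cos \<theta> * cos (real (Suc n) * \<theta>) - cos (real n * \<theta>)"
        using pq by (simp del: of_nat_Suc)
      also have "\<dots> = cos (real (Suc (Suc n)) * \<theta>)"
        unfolding 1 2 by (simp only: cos_add cos_diff) simp
      finally show "poly ([:0, 2:] * q - p) (cos \<theta>) = cos (real (Suc (Suc n)) * \<theta>)" .
    qed
  qed
  then obtain T :: "real poly" where T: "\<And>\<theta>. poly T (cos \<theta>) = cos (real (k + 1) * \<theta>)"
    by blast
  have "pderiv T = Polynomial.smult (real (k + 1)) (chebyshev_U k)"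
  proof (rule poly_eq_if_eq_on_cos)
    fix \<theta> :: real
    assume s: "sin \<theta> \<noteq> 0"
    have "((\<lambda>\<theta>. poly T (cos \<theta>)) has_real_derivative poly (pderiv T) (cos \<theta>) * - sin \<theta>) (at \<theta>)"
      by (auto intro!: derivative_eq_intros DERIV_chain2[OF poly_DERIV])
    moreover have "((\<lambda>\<theta>. cos (real (k + 1) * \<theta>)) has_real_derivative
        - sin (real (k + 1) * \<theta>) * real (k + 1)) (at \<theta>)"
      by (auto intro!: derivative_eq_intros)
    ultimately have "poly (pderiv T) (cos \<theta>) * - sin \<theta> = - sin (real (k + 1) * \<theta>) * real (k + 1)"
      unfolding T by (rule DERIV_unique)
    then show "poly (pderiv T) (cos \<theta>)
        = poly (Polynomial.smult (real (k + 1)) (chebyshev_U k)) (cos \<theta>)"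
      using s by (simp add: poly_chebyshev_U_cos field_simps del: of_nat_Suc)
  qed
  with T show ?thesis by (rule that)
qed

text \<open>At the ends of the chord the argument is \<open>cos (\<psi> + \<alpha>)\<close> or
  \<open>cos (\<psi> - \<alpha>)\<close>, so the antiderivative yields a difference of cosines,
  which factors into sines. It involves a division by \<open>sin \<alpha>\<close>; when that is
  zero, the integrand is constant.\<close>

lemma has_integral_chebyshev_U_chord:
  assumes \<psi>: "0 \<le> sin \<psi>"
  shows "((\<lambda>s. poly (chebyshev_U k) (cos \<psi> * cos \<alpha> - s * sin \<alpha>)) has_integral
      2 / real (k + 1) * sin (real (k + 1) * \<psi>) * poly (chebyshev_U k) (cos \<alpha>))
    {- sin \<psi>..sin \<psi>}"
proof (cases "sin \<alpha> = 0")
  case True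
  let ?n = "real (k + 1)"
  have c2: "cos \<alpha> * cos \<alpha> = 1"
    using True sin_cos_squared_add[of \<alpha>] by (simp add: power2_eq_square)
  have sn: "sin (?n * \<alpha>) = 0"
    using chebyshev_U_cos_mult_sin[of k \<alpha>] True by simp
  have cs: "cos (\<psi> + \<alpha>) = cos \<psi> * cos \<alpha>" "sin (\<psi> + \<alpha>) = sin \<psi> * cos \<alpha>"
    using True by (simp_all add: cos_add sin_add)
  have "poly (chebyshev_U k) (cos \<psi> * cos \<alpha>) * (sin \<psi> * cos \<alpha>) = sin (?n * \<psi> + ?n * \<alpha>)"
    using chebyshev_U_cos_mult_sin[of k "\<psi> + \<alpha>"] unfolding cs by (simp add: ring_distribs)
  also have "\<dots> = sin (?n * \<psi>) * cos (?n * \<alpha>)"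
    using sn by (simp add: sin_add)
  finally have "?n * (poly (chebyshev_U k) (cos \<psi> * cos \<alpha>) * (sin \<psi> * cos \<alpha>) * cos \<alpha>)
      = sin (?n * \<psi>) * (?n * cos (?n * \<alpha>)) * cos \<alpha>"
    by simp
  also have "?n * cos (?n * \<alpha>) = poly (chebyshev_U k) (cos \<alpha>) * cos \<alpha>"
    using chebyshev_U_cos_if_sin_eq_0[OF True] by simp
  finally have "?n * (poly (chebyshev_U k) (cos \<psi> * cos \<alpha>) * sin \<psi> * (cos \<alpha> * cos \<alpha>))
      = sin (?n * \<psi>) * poly (chebyshev_U k) (cos \<alpha>) * (cos \<alpha> * cos \<alpha>)"
    by (simp only: mult_ac)
  then have eq: "poly (chebyshev_U k) (cos \<psi> * cos \<alpha>) * sin \<psi>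
      = sin (?n * \<psi>) * poly (chebyshev_U k) (cos \<alpha>) / ?n"
    unfolding c2 by (simp add: field_simps)
  have "((\<lambda>s. poly (chebyshev_U k) (cos \<psi> * cos \<alpha>)) has_integral
      2 * (poly (chebyshev_U k) (cos \<psi> * cos \<alpha>) * sin \<psi>)) {- sin \<psi>..sin \<psi>}"
    using has_integral_const_real[of "poly (chebyshev_U k) (cos \<psi> * cos \<alpha>)" "- sin \<psi>" "sin \<psi>"] \<psi>
    by (simp add: mult_ac)
  then show ?thesis
    unfolding eq using True by (simp add: mult_ac)
next
  case False
  let ?n = "real (k + 1)"
  obtain T :: "real poly" where T: "\<And>\<theta>. poly T (cos \<theta>) = cos (?n * \<theta>)"
    and T': "pderiv T = Polynomial.smult ?n (chebyshev_U k)"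
    using chebyshev_U_antiderivative[of k] by metis
  define F where "F s = - poly T (cos \<psi> * cos \<alpha> - s * sin \<alpha>) / (?n * sin \<alpha>)" for s
  have "(F has_real_derivative poly (chebyshev_U k) (cos \<psi> * cos \<alpha> - s * sin \<alpha>)) (at s)" for s
  proof -
    have "((\<lambda>s. poly T (cos \<psi> * cos \<alpha> - s * sin \<alpha>)) has_real_derivative
        poly (pderiv T) (cos \<psi> * cos \<alpha> - s * sin \<alpha>) * (- sin \<alpha>)) (at s)"
      by (auto intro!: derivative_eq_intros DERIV_chain2[OF poly_DERIV])
    from DERIV_cdivide[OF DERIV_minus[OF this], of "?n * sin \<alpha>"]
    show ?thesis using False unfolding F_def T' by (simp del: of_nat_Suc of_nat_add)
  qed
  then have "((\<lambda>s. poly (chebyshev_U k) (cos \<psi> * cos \<alpha> - s * sin \<alpha>)) has_integral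
      F (sin \<psi>) - F (- sin \<psi>)) {- sin \<psi>..sin \<psi>}"
    using \<psi>
    by (intro fundamental_theorem_of_calculus)
      (auto simp: has_real_derivative_iff_has_vector_derivative
        intro: has_vector_derivative_at_within)
  moreover have "F (sin \<psi>) - F (- sin \<psi>) = (cos (?n * (\<psi> - \<alpha>)) - cos (?n * (\<psi> + \<alpha>))) / (?n * sin \<alpha>)"
    unfolding F_def T[symmetric] by (simp add: cos_add cos_diff diff_divide_distrib)
  moreover have "cos (?n * (\<psi> - \<alpha>)) - cos (?n * (\<psi> + \<alpha>)) = 2 * sin (?n * \<psi>) * sin (?n * \<alpha>)"
    unfolding distrib_left right_diff_distrib cos_add cos_diff by simp
  ultimately show ?thesis
    using False by (simp add: poly_chebyshev_U_cos)
qed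

text \<open>
  The \<open>k + 1\<close> angles of degree \<open>k\<close> are spaced by \<open>\<pi> / (k + 1)\<close>, which makes
  \<open>U\<^sub>k\<close> of the cosines of their differences vanish, and are shifted into
  \<open>(-\<pi>/2, \<pi>/2)\<close> so that their tangents are defined and distinct.
\<close>
definition ridge_angle :: "nat \<Rightarrow> nat \<Rightarrow> real" where
  "ridge_angle k i = (2 * real i + 1) * pi / (2 * (real k + 1)) - pi / 2"

text \<open>For each \<open>k\<close> there are as many weights as monomials of degree
  \<open>k\<close>.\<close>

definition ridge_sum :: "nat \<Rightarrow> (nat \<Rightarrow> nat \<Rightarrow> real) \<Rightarrow> real \<times> real \<Rightarrow> real" where
  "ridge_sum n w z = (\<Sum>k\<le>n. \<Sum>i\<le>k. w k i *
     poly (chebyshev_U k) (fst z * cos (ridge_angle k i) + snd z * sin (ridge_angle k i)))"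

text \<open>Along the chord, a ridge of angle \<open>\<eta>\<close> has the argument treated in
  \<open>has_integral_chebyshev_U_chord\<close>, with \<open>\<alpha>\<close> equal to
  \<open>\<theta> - \<eta>\<close>.\<close>

lemma radon_ridge_sum:
  assumes \<psi>: "0 \<le> sin \<psi>"
  shows "radon \<theta> (ridge_sum n w) (cos \<psi>) = (\<Sum>k\<le>n. \<Sum>i\<le>k. w k i *
    (2 / real (k + 1) * sin (real (k + 1) * \<psi>) *
      poly (chebyshev_U k) (cos (\<theta> - ridge_angle k i))))"
proof -
  have "1 - (cos \<psi>)\<^sup>2 = (sin \<psi>)\<^sup>2"
    by (simp add: sin_squared_eq)
  then have "sqrt (1 - (cos \<psi>)\<^sup>2) = sin \<psi>"
    using \<psi> by simp
  moreover have "(cos \<psi> * cos \<theta> - s * sin \<theta>) * cos \<eta> + (cos \<psi> * sin \<theta> + s * cos \<theta>) * sin \<eta>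
      = cos \<psi> * cos (\<theta> - \<eta>) - s * sin (\<theta> - \<eta>)" for s \<eta>
    by (simp add: cos_diff sin_diff algebra_simps)
  ultimately show ?thesis
    unfolding radon_def ridge_sum_def
    by (simp only: fst_conv snd_conv)
      (intro integral_unique has_integral_sum finite_atMost has_integral_mult_right
        has_integral_chebyshev_U_chord[OF \<psi>])
qed

lemma
  shows ridge_sum_add: "ridge_sum n v z + ridge_sum n w z = ridge_sum n (\<lambda>k i. v k i + w k i) z"
    and ridge_sum_scale: "c * ridge_sum n w z = ridge_sum n (\<lambda>k i. c * w k i) z"
    and ridge_sum_diff: "ridge_sum n v z - ridge_sum n w z = ridge_sum n (\<lambda>k i. v k i - w k i) z"
  by (simp_all add: ridge_sum_def sum.distrib sum_subtractf sum_distrib_left algebra_simps)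

subsection \<open>Ridge expansions of bivariate polynomials\<close>

definition ridge_space :: "nat \<Rightarrow> (real \<times> real \<Rightarrow> real) set" where
  "ridge_space n = range (ridge_sum n)"

lemma ridge_space_add:
  assumes "f \<in> ridge_space n" "g \<in> ridge_space n"
  shows "(\<lambda>z. f z + g z) \<in> ridge_space n"
  using assms unfolding ridge_space_def
  by (auto simp: ridge_sum_add intro!: rangeI)

lemma ridge_space_scale:
  assumes "f \<in> ridge_space n"
  shows "(\<lambda>z. c * f z) \<in> ridge_space n"
  using assms unfolding ridge_space_def
  by (auto simp: ridge_sum_scale intro!: rangeI)

lemma ridge_space_diff:
  assumes "f \<in> ridge_space n" "g \<in> ridge_space n"
  shows "(\<lambda>z. f z - g z) \<in> ridge_space n"
  using assms unfolding ridge_space_def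
  by (auto simp: ridge_sum_diff intro!: rangeI)

lemma ridge_space_sum:
  assumes "\<And>a. a \<in> A \<Longrightarrow> f a \<in> ridge_space n"
  shows "(\<lambda>z. \<Sum>a\<in>A. f a z) \<in> ridge_space n"
proof -
  have zero: "(\<lambda>z. 0) \<in> ridge_space n"
  proof -
    have "(\<lambda>z. 0) = ridge_sum n (\<lambda>k i. 0)" by (simp add: ridge_sum_def fun_eq_iff)
    then show ?thesis unfolding ridge_space_def by simp
  qed
  show ?thesis
    using assms
    by (induction A rule: infinite_finite_induct) (auto simp: zero intro: ridge_space_add)
qed

lemma ridge_space_mono:
  assumes "k \<le> n"
  shows "ridge_space k \<subseteq> ridge_space n"
proof
  fix f assume "f \<in> ridge_space k"
  then obtain w where w: "f = ridge_sum k w" by (auto simp: ridge_space_def)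
  have "ridge_sum n (\<lambda>l i. if l \<le> k then w l i else 0) z = ridge_sum k w z" for z
    unfolding ridge_sum_def using assms by (intro sum.mono_neutral_cong_right) auto
  then have "f = ridge_sum n (\<lambda>l i. if l \<le> k then w l i else 0)" unfolding w by auto
  then show "f \<in> ridge_space n" by (simp add: ridge_space_def)
qed

lemma ridge_in_ridge_space:
  assumes "i \<le> k"
  shows "(\<lambda>z. poly (chebyshev_U k) (fst z * cos (ridge_angle k i) + snd z * sin (ridge_angle k i)))
    \<in> ridge_space k"
proof -
  have "ridge_sum k (\<lambda>l j. if l = k \<and> j = i then 1 else 0) z =
      poly (chebyshev_U k) (fst z * cos (ridge_angle k i) + snd z * sin (ridge_angle k i))" for z
  proof -
    have "ridge_sum k (\<lambda>l j. if l = k \<and> j = i then 1 else 0) z =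
        (\<Sum>l\<le>k. if l = k then (\<Sum>j\<le>k. if j = i then
          poly (chebyshev_U k) (fst z * cos (ridge_angle k i) + snd z * sin (ridge_angle k i))
          else 0) else 0)"
      unfolding ridge_sum_def by (intro sum.cong refl)
        (auto simp: if_distrib[of "\<lambda>c. c * _"] cong: if_cong)
    then show ?thesis using assms by simp
  qed
  then have "(\<lambda>z. poly (chebyshev_U k) (fst z * cos (ridge_angle k i) + snd z * sin (ridge_angle k i)))
      = ridge_sum k (\<lambda>l j. if l = k \<and> j = i then 1 else 0)" by auto
  then show ?thesis by (simp add: ridge_space_def)
qed

text \<open>Inverts a Vandermonde matrix; the weights are coefficients of the Lagrange basis.\<close>
lemma lagrange_dual_weights:
  fixes s :: "nat \<Rightarrow> 'a :: field"
  assumes inj: "inj_on s {..k}"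
  shows "\<exists>v. \<forall>l\<le>k. (\<Sum>i\<le>k. v i * s i ^ l) = (if l = j then 1 else 0)"
proof (intro exI allI impI)
  define L where "L i = (\<Prod>r\<in>{..k} - {i}. [:- s r / (s i - s r), 1 / (s i - s r):])" for i
  fix l assume l: "l \<le> k"
  have ne: "s i - s r \<noteq> 0" if "i \<le> k" "r \<le> k" "i \<noteq> r" for i r
    using inj_onD[OF inj, of i r] that by auto
  have deg: "degree (L i) \<le> k" if "i \<le> k" for i
  proof -
    have linear: "degree [:a, b:] \<le> 1" for a b :: 'a
      using degree_pCons_le[of a "[:b:]"] by simp
    have "degree (L i) \<le> (\<Sum>r\<in>{..k} - {i}. degree [:- s r / (s i - s r), 1 / (s i - s r):])"
      unfolding L_def using degree_prod_sum_le[of "{..k} - {i}"] unfolding o_def by blast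
    also have "\<dots> \<le> (\<Sum>r\<in>{..k} - {i}. 1)"
      by (intro sum_mono linear)
    also have "\<dots> = k" using that by simp
    finally show ?thesis .
  qed
  have ev: "poly (L i) (s r) = (if i = r then 1 else 0)" if "i \<le> k" "r \<le> k" for i r
  proof (cases "i = r")
    case True
    have "(- s t / (s i - s t)) + s i * (1 / (s i - s t)) = 1" if "t \<in> {..k} - {i}" for t
    proof -
      have "- b / c + a * (1 / c) = (a - b) / c" for a b c :: 'a
        by (simp add: diff_divide_distrib)
      from this[of "s t" "s i - s t" "s i"] show ?thesis
        using ne[of i t] that \<open>i \<le> k\<close> by simp
    qed
    then show ?thesis unfolding L_def poly_prod True[symmetric] by simp
  next
    case False
    then have "(\<Prod>t\<in>{..k} - {i}. poly [:- s t / (s i - s t), 1 / (s i - s t):] (s r)) = 0"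
      using that by (intro prod_zero) (auto intro!: bexI[of _ r])
    then show ?thesis using False unfolding L_def poly_prod by simp
  qed
  \<comment> \<open>Interpolation at \<open>k + 1\<close> points is exact up to degree
    \<open>k\<close>. Comparing coefficients of degree \<open>j\<close> then supplies the witness
    \<open>coeff (L i) j\<close>.\<close>
  have "monom 1 l = (\<Sum>i\<le>k. Polynomial.smult (s i ^ l) (L i))"
  proof (rule poly_eqI_degree)
    fix x assume "x \<in> s ` {..k}"
    then obtain r where r: "r \<le> k" "x = s r" by auto
    have "(\<Sum>i\<le>k. s i ^ l * poly (L i) (s r)) = (\<Sum>i\<le>k. if i = r then s i ^ l else 0)"
      using r by (intro sum.cong) (auto simp: ev)
    then show "poly (monom 1 l) x = poly (\<Sum>i\<le>k. Polynomial.smult (s i ^ l) (L i)) x"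
      using r by (simp add: poly_monom poly_sum)
  next
    show "degree (monom (1 :: 'a) l) < card (s ` {..k})"
      using l by (simp add: card_image[OF inj] degree_monom_eq)
    have "degree (\<Sum>i\<le>k. Polynomial.smult (s i ^ l) (L i)) \<le> k"
      by (intro degree_sum_le) (auto intro: order.trans[OF degree_smult_le] deg)
    then show "degree (\<Sum>i\<le>k. Polynomial.smult (s i ^ l) (L i)) < card (s ` {..k})"
      by (simp add: card_image[OF inj])
  qed
  from arg_cong[OF this, of "\<lambda>p. coeff p j"]
  show "(\<Sum>i\<le>k. coeff (L i) j * s i ^ l) = (if l = j then 1 else 0)"
    by (simp add: coeff_sum mult.commute)
qed

lemma ridge_angle_bounds:
  assumes "i \<le> k"
  shows "- (pi / 2) < ridge_angle k i" and "ridge_angle k i < pi / 2"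
proof -
  have "(2 * real i + 1) / (2 * (real k + 1)) < 1"
    using assms by simp
  then have "(2 * real i + 1) / (2 * (real k + 1)) * pi < 1 * pi"
    by (intro mult_strict_right_mono) auto
  then show "ridge_angle k i < pi / 2"
    unfolding ridge_angle_def times_divide_eq_left by linarith
  show "- (pi / 2) < ridge_angle k i"
    by (simp add: ridge_angle_def)
qed

lemma inj_on_tan_ridge_angle: "inj_on (\<lambda>i. tan (ridge_angle k i)) {..k}"
proof (rule inj_onI)
  fix i j assume "i \<in> {..k}" "j \<in> {..k}" and eq: "tan (ridge_angle k i) = tan (ridge_angle k j)"
  then have "ridge_angle k i = ridge_angle k j"
    using ridge_angle_bounds arctan_tan by (metis atMost_iff)
  then have "(2 * real i + 1) * pi / (2 * (real k + 1)) = (2 * real j + 1) * pi / (2 * (real k + 1))"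
    unfolding ridge_angle_def by linarith
  moreover have "2 * (real k + 1) \<noteq> 0" "pi \<noteq> 0" by simp_all
  ultimately show "i = j"
    unfolding divide_cancel_right mult_cancel_right by auto
qed

text \<open>With the cosine factored out, a ridge power becomes a power of x + y tan \<eta>. In its
  binomial expansion the weights dual to the powers of the tangents select the term with
  \<open>y ^ b\<close>.\<close>

lemma monomial_eq_ridge_powers:
  assumes "a + b = k"
  shows "\<exists>v. \<forall>x y. x ^ a * y ^ b =
    (\<Sum>i\<le>k. v i * (x * cos (ridge_angle k i) + y * sin (ridge_angle k i)) ^ k)"
proof -
  define s where "s i = tan (ridge_angle k i)" for i
  have cos_nz: "cos (ridge_angle k i) \<noteq> 0" if "i \<le> k" for i
    using ridge_angle_bounds[OF that] cos_gt_zero_pi by fastforce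
  obtain v where v: "\<And>l. l \<le> k \<Longrightarrow> (\<Sum>i\<le>k. v i * s i ^ l) = (if l = b then 1 else 0)"
    using lagrange_dual_weights[OF inj_on_tan_ridge_angle[of k], of b] unfolding s_def by blast
  define u where "u i = v i / (cos (ridge_angle k i) ^ k * real (k choose b))" for i
  have "x ^ a * y ^ b = (\<Sum>i\<le>k. u i * (x * cos (ridge_angle k i) + y * sin (ridge_angle k i)) ^ k)"
    for x y
  proof -
    have nz: "real (k choose b) \<noteq> 0" using assms by simp
    have "u i * (x * cos (ridge_angle k i) + y * sin (ridge_angle k i)) ^ k
        = (\<Sum>l\<le>k. real (k choose l) * y ^ l * x ^ (k - l) / real (k choose b) * (v i * s i ^ l))"
      if "i \<le> k" for i
    proof -
      have "x * cos (ridge_angle k i) + y * sin (ridge_angle k i)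
          = cos (ridge_angle k i) * (s i * y + x)"
        using cos_nz[OF that] by (simp add: s_def tan_def field_simps)
      then have "u i * (x * cos (ridge_angle k i) + y * sin (ridge_angle k i)) ^ k
          = v i / real (k choose b) * (s i * y + x) ^ k"
        using cos_nz[OF that] by (simp add: u_def power_mult_distrib)
      also have "\<dots> = (\<Sum>l\<le>k. real (k choose l) * y ^ l * x ^ (k - l) / real (k choose b) * (v i * s i ^ l))"
        unfolding binomial_ring sum_distrib_left
        by (intro sum.cong) (auto simp: power_mult_distrib)
      finally show ?thesis .
    qed
    then have "(\<Sum>i\<le>k. u i * (x * cos (ridge_angle k i) + y * sin (ridge_angle k i)) ^ k)
        = (\<Sum>i\<le>k. \<Sum>l\<le>k. real (k choose l) * y ^ l * x ^ (k - l) / real (k choose b) * (v i * s i ^ l))"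
      by simp
    also have "\<dots> = (\<Sum>l\<le>k. real (k choose l) * y ^ l * x ^ (k - l) / real (k choose b)
        * (\<Sum>i\<le>k. v i * s i ^ l))"
      by (subst sum.swap) (simp add: sum_distrib_left)
    also have "\<dots> = (\<Sum>l\<le>k. if l = b then y ^ b * x ^ (k - b) else 0)"
      using nz by (intro sum.cong) (auto simp: v)
    also have "\<dots> = x ^ a * y ^ b"
      using assms by auto
    finally show ?thesis by simp
  qed
  then show ?thesis by blast
qed

text \<open>Ridge powers of degree \<open>k\<close> span the monomials of that degree, and each is a
  multiple of \<open>U_k\<close> of the ridge minus lower powers, which the induction
  covers.\<close>

lemma monomial_in_ridge_space: "(\<lambda>z. fst z ^ a * snd z ^ b) \<in> ridge_space (a + b)"
proof (induction "a + b" arbitrary: a b rule: less_induct)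
  case less
  define k where "k = a + b"
  \<comment> \<open>Arbitrary \<open>c\<close> and \<open>d\<close> are needed: the ridge angles of
    degree \<open>k\<close> are in general not those of degree \<open>l\<close>, so the power is
    expanded into monomials.\<close>
  have lower: "(\<lambda>z. (fst z * c + snd z * d) ^ l) \<in> ridge_space k" if "l < k" for l c d
  proof -
    have "(\<lambda>z. fst z ^ r * snd z ^ (l - r)) \<in> ridge_space k" if "r \<le> l" for r
      using less[of r "l - r"] ridge_space_mono[of l k] that \<open>l < k\<close> by (auto simp: k_def)
    then have "(\<lambda>z. \<Sum>r\<le>l. (real (l choose r) * c ^ r * d ^ (l - r)) * (fst z ^ r * snd z ^ (l - r)))
        \<in> ridge_space k"
      by (intro ridge_space_sum ridge_space_scale) auto
    also have "(\<lambda>z. \<Sum>r\<le>l. (real (l choose r) * c ^ r * d ^ (l - r)) * (fst z ^ r * snd z ^ (l - r)))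
        = (\<lambda>z. (fst z * c + snd z * d) ^ l)"
      by (simp add: binomial_ring power_mult_distrib mult_ac)
    finally show ?thesis .
  qed
  have top: "(\<lambda>z. (fst z * cos (ridge_angle k i) + snd z * sin (ridge_angle k i)) ^ k)
      \<in> ridge_space k" if "i \<le> k" for i
  proof -
    let ?L = "\<lambda>z :: real \<times> real. fst z * cos (ridge_angle k i) + snd z * sin (ridge_angle k i)"
    have "poly (chebyshev_U k) x = 2 ^ k * x ^ k + (\<Sum>l<k. coeff (chebyshev_U k) l * x ^ l)" for x
    proof -
      have "poly (chebyshev_U k) x = (\<Sum>l\<le>k. coeff (chebyshev_U k) l * x ^ l)"
        unfolding poly_altdef using degree_chebyshev_U_le[of k]
        by (intro sum.mono_neutral_left) (auto simp: coeff_eq_0)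
      then show ?thesis
        by (simp add: lessThan_Suc_atMost[symmetric] coeff_chebyshev_U_top)
    qed
    then have "(\<lambda>z. ?L z ^ k) = (\<lambda>z. 1 / 2 ^ k *
        (poly (chebyshev_U k) (?L z) - (\<Sum>l<k. coeff (chebyshev_U k) l * ?L z ^ l)))"
      by simp
    also have "\<dots> \<in> ridge_space k"
      by (intro ridge_space_scale ridge_space_diff ridge_space_sum ridge_in_ridge_space lower that)
        auto
    finally show ?thesis .
  qed
  obtain v where v: "\<And>x y. x ^ a * y ^ b =
      (\<Sum>i\<le>k. v i * (x * cos (ridge_angle k i) + y * sin (ridge_angle k i)) ^ k)"
    using monomial_eq_ridge_powers[of a b k] unfolding k_def by blast
  have "(\<lambda>z. \<Sum>i\<le>k. v i * (fst z * cos (ridge_angle k i) + snd z * sin (ridge_angle k i)) ^ k)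
      \<in> ridge_space k"
    by (intro ridge_space_sum ridge_space_scale top) auto
  then show ?case unfolding v k_def .
qed

lemma poly2_space_subset_ridge_space: "poly2_space n \<subseteq> ridge_space n"
proof
  fix f assume "f \<in> poly2_space n"
  then obtain c where "f = (\<lambda>(x, y). \<Sum>i\<le>n. \<Sum>j\<le>n - i. c i j * x ^ i * y ^ j)"
    unfolding poly2_space_def by blast
  then have f: "f = (\<lambda>z. \<Sum>i\<le>n. \<Sum>j\<le>n - i. c i j * (fst z ^ i * snd z ^ j))"
    by (auto simp: mult.assoc)
  have "(\<lambda>z. fst z ^ i * snd z ^ j) \<in> ridge_space n" if "i \<le> n" "j \<le> n - i" for i j
  proof -
    have "i + j \<le> n" using that by simp
    then show ?thesis using monomial_in_ridge_space[of i j] ridge_space_mono by blast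
  qed
  then show "f \<in> ridge_space n"
    unfolding f by (intro ridge_space_sum ridge_space_scale) auto
qed

subsection \<open>Uniqueness from discrete Radon data\<close>

text \<open>Writing \<open>cis \<theta>\<close> as
  \<open>cis (\<eta> i) * cis (\<theta> - \<eta> i)\<close> reduces each summand to
  \<open>chebyshev_U_cis\<close>; the shifts only change coefficients.\<close>

lemma chebyshev_U_sum_cis_poly:
  fixes w \<eta> :: "nat \<Rightarrow> real"
  shows "\<exists>p. degree p \<le> d \<and> (\<forall>\<theta>.
    complex_of_real (\<Sum>i\<in>I. w i * poly (chebyshev_U d) (cos (\<theta> - \<eta> i))) * cis \<theta> ^ d
      = poly p (cis (2 * \<theta>)))"
proof (intro exI conjI allI)
  let ?q = "\<lambda>i. \<Sum>l\<le>d. monom (cis (- 2 * \<eta> i) ^ l) l"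
  let ?p = "\<Sum>i\<in>I. Polynomial.smult (of_real (w i) * cis (\<eta> i) ^ d) (?q i)"
  show "degree ?p \<le> d"
  proof (cases "finite I")
    case True
    have "degree (?q i) \<le> d" for i
      by (intro degree_sum_le) (auto intro: order.trans[OF degree_monom_le])
    then show ?thesis
      using True by (intro degree_sum_le) (auto intro: order.trans[OF degree_smult_le])
  qed simp
  fix \<theta> :: real
  have summand: "complex_of_real (w i * poly (chebyshev_U d) (cos (\<theta> - \<eta> i))) * cis \<theta> ^ d
      = of_real (w i) * cis (\<eta> i) ^ d * poly (?q i) (cis (2 * \<theta>))" for i
  proof -
    have c: "cis \<theta> = cis (\<eta> i) * cis (\<theta> - \<eta> i)" by (simp add: cis_mult)
    have "complex_of_real (w i * poly (chebyshev_U d) (cos (\<theta> - \<eta> i))) * cis \<theta> ^ d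
        = of_real (w i) * cis (\<eta> i) ^ d
          * (complex_of_real (poly (chebyshev_U d) (cos (\<theta> - \<eta> i))) * cis (\<theta> - \<eta> i) ^ d)"
      unfolding c power_mult_distrib by simp
    also have "\<dots> = of_real (w i) * cis (\<eta> i) ^ d * poly (?q i) (cis (2 * \<theta>))"
      unfolding chebyshev_U_cis
      by (simp add: poly_sum poly_monom power_mult_distrib[symmetric] cis_mult algebra_simps)
    finally show ?thesis .
  qed
  show "complex_of_real (\<Sum>i\<in>I. w i * poly (chebyshev_U d) (cos (\<theta> - \<eta> i))) * cis \<theta> ^ d
      = poly ?p (cis (2 * \<theta>))"
    unfolding of_real_sum sum_distrib_right summand by (simp add: poly_sum)
qed

text \<open>
  \<open>A\<close> and \<open>B\<close> have \<open>d + 1\<close> and \<open>d' + 1\<close> frequencies, which together fill each residue class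
  modulo \<open>2m + 1\<close> exactly once; so agreement on the equispaced directions leaves no aliasing.
\<close>
lemma complementary_trig_vanish:
  fixes A B :: "real \<Rightarrow> real"
  assumes deg: "degree p \<le> d" "degree q \<le> d'" and d: "d + d' + 1 = 2 * m"
    and p: "\<And>\<theta>. complex_of_real (A \<theta>) * cis \<theta> ^ d = poly p (cis (2 * \<theta>))"
    and q: "\<And>\<theta>. complex_of_real (B \<theta>) * cis \<theta> ^ d' = poly q (cis (2 * \<theta>))"
    and AB: "\<And>j. j \<le> 2 * m \<Longrightarrow> A (direction j m) = B (direction j m)"
  shows "A \<theta> = 0"
proof -
  define R where "R = {z :: complex. z ^ (2 * m + 1) = 1}"
  \<comment> \<open>The factor lifts the powers in \<open>q\<close> above \<open>d\<close>, away
    from those in \<open>p\<close>.\<close>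
  define r where "r = monom 1 (d + 1) * q"
  have eq: "poly p z = poly r z" if z: "z \<in> R" for z
  proof -
    \<comment> \<open>Modulo \<open>2 * m + 1\<close>, \<open>m + 1\<close> is the inverse of 2.
      Hence \<open>z ^ (m + 1)\<close> is a square root of \<open>z\<close> that is again a root of
      unity, so it is \<open>cis\<close> of some direction.\<close>
    have root: "(z ^ (m + 1)) ^ (2 * m + 1) = 1"
    proof -
      have "(z ^ (m + 1)) ^ (2 * m + 1) = (z ^ (2 * m + 1)) ^ (m + 1)"
        unfolding power_mult[symmetric] by (simp only: mult.commute)
      also have "z ^ (2 * m + 1) = 1" using z unfolding R_def by blast
      finally show ?thesis by simp
    qed
    have "(\<lambda>j. cis (2 * pi * real j / real (2 * m + 1))) ` {..<2 * m + 1}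
        = {z. z ^ (2 * m + 1) = 1}"
      by (rule bij_betw_imp_surj_on[OF Complex.bij_betw_roots_unity]) simp
    with root have "z ^ (m + 1) \<in> (\<lambda>j. cis (2 * pi * real j / real (2 * m + 1))) ` {..<2 * m + 1}"
      by blast
    then obtain j where j: "j < 2 * m + 1" "z ^ (m + 1) = cis (2 * pi * real j / real (2 * m + 1))"
      by blast
    define \<omega> where "\<omega> = cis (direction j m)"
    have \<omega>: "z ^ (m + 1) = \<omega>"
      unfolding \<omega>_def j(2) direction_def by (simp add: ac_simps)
    have "\<omega> * \<omega> = z ^ (2 * m + 1) * z"
      unfolding \<omega>[symmetric] power_add[symmetric] by (simp add: mult_2 power_add)
    then have sq: "\<omega> * \<omega> = z" using z by (simp add: R_def)
    then have z2: "z = cis (2 * direction j m)" by (simp add: \<omega>_def cis_mult)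
    have per: "\<omega> ^ (2 * m + 1) = 1" using root unfolding \<omega> .
    have "poly p z = complex_of_real (B (direction j m)) * \<omega> ^ d"
      using p[of "direction j m"] AB[of j] j(1) unfolding z2 \<omega>_def by simp
    \<comment> \<open>A full period added to the exponent makes it \<open>d'\<close> plus an even
      number, and even powers of \<open>\<omega>\<close> are powers of \<open>z\<close>.\<close>
    also have "\<dots> = complex_of_real (B (direction j m)) * \<omega> ^ (d + (2 * m + 1))"
      unfolding power_add[of \<omega> d] per by simp
    also have "d + (2 * m + 1) = d' + 2 * (d + 1)" using d by simp
    also have "complex_of_real (B (direction j m)) * \<omega> ^ (d' + 2 * (d + 1))
        = (complex_of_real (B (direction j m)) * \<omega> ^ d') * (\<omega> * \<omega>) ^ (d + 1)"
      by (simp add: power_add power_mult power2_eq_square)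
    also have "\<dots> = poly q z * z ^ (d + 1)"
      unfolding sq using q[of "direction j m"] unfolding z2 \<omega>_def by simp
    finally show ?thesis by (simp add: r_def poly_monom mult_ac)
  qed
  have "degree r \<le> d + 1 + d'"
    unfolding r_def using deg(2) degree_mult_le[of "monom (1 :: complex) (d + 1)" q]
    by (simp add: degree_monom_eq)
  \<comment> \<open>Both degrees are at most \<open>2 * m\<close>, and \<open>R\<close> has
    \<open>2 * m + 1\<close> points.\<close>
  then have "p = r"
    using deg(1) d eq Complex.card_roots_unity_eq[of "2 * m + 1"]
    by (intro poly_eqI_degree[of R]) (auto simp: R_def)
  have "coeff p l = 0" for l
  proof (cases "l \<le> d")
    case True
    have "coeff p l = coeff r l" using \<open>p = r\<close> by simp
    also have "\<dots> = 0" using True by (simp add: r_def coeff_monom_mult)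
    finally show ?thesis .
  qed (use deg(1) in \<open>simp add: coeff_eq_0\<close>)
  then have "p = 0" by (simp add: poly_eq_iff)
  then show ?thesis using p[of \<theta>] by simp
qed

text \<open>For distinct indices, \<open>k + 1\<close> times the difference of the angles is a
  multiple of pi, while the difference itself is nonzero and below pi in absolute value.\<close>

lemma chebyshev_U_ridge_angle_diff:
  assumes "i \<le> k" "l \<le> k"
  shows "poly (chebyshev_U k) (cos (ridge_angle k l - ridge_angle k i))
    = (if i = l then real (k + 1) else 0)"
proof (cases "i = l")
  case True
  then show ?thesis using chebyshev_U_cos_if_sin_eq_0[of 0 k] by simp
next
  case False
  let ?\<alpha> = "ridge_angle k l - ridge_angle k i"
  have "(2 * x + 1) * pi / (2 * n) = x * pi / n + pi / (2 * n)" if "n \<noteq> 0" for x n :: real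
    using that by (simp add: field_simps)
  from this[of "real k + 1"] have "?\<alpha> = (real l - real i) * pi / real (k + 1)"
    by (simp add: ridge_angle_def diff_divide_distrib left_diff_distrib add.commute)
  then have "real (k + 1) * ?\<alpha> = of_int (int l - int i) * pi"
    by simp
  then have z: "sin (real (k + 1) * ?\<alpha>) = 0"
    unfolding sin_zero_iff_int2 by blast
  have "tan (ridge_angle k i) \<noteq> tan (ridge_angle k l)"
    using inj_onD[OF inj_on_tan_ridge_angle[of k], of i l] assms False by auto
  then have ne: "ridge_angle k i \<noteq> ridge_angle k l" by auto
  have "\<bar>?\<alpha>\<bar> < pi"
    using ridge_angle_bounds[OF assms(1)] ridge_angle_bounds[OF assms(2)] by auto
  then have "sin ?\<alpha> \<noteq> 0"
  proof (cases "?\<alpha> > 0")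
    case True
    then show ?thesis using sin_gt_zero[of ?\<alpha>] \<open>\<bar>?\<alpha>\<bar> < pi\<close> by linarith
  next
    case False
    then show ?thesis using sin_gt_zero[of "- ?\<alpha>"] sin_minus[of ?\<alpha>] \<open>\<bar>?\<alpha>\<bar> < pi\<close> ne by linarith
  qed
  then show ?thesis
    using z False by (simp add: poly_chebyshev_U_cos del: of_nat_Suc of_nat_add)
qed

lemma radon_ridge_sum_data_injective:
  assumes m: "m \<ge> 1"
    and data: "\<And>j k. j \<le> 2 * m \<Longrightarrow> k \<in> {1..m} \<Longrightarrow>
      radon (direction j m) (ridge_sum (2 * m - 1) v) (node m k)
        = radon (direction j m) (ridge_sum (2 * m - 1) w) (node m k)"
    and d: "d < 2 * m" and i: "i \<le> d"
  shows "v d i = w d i"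
proof -
  \<comment> \<open>The coefficient of \<open>U_d\<close> in the difference of the two data, with
    the common factor \<open>sin \<psi>\<close> removed.\<close>
  define A where "A d \<theta> = (\<Sum>i\<le>d. (2 / real (d + 1) * (v d i - w d i))
    * poly (chebyshev_U d) (cos (\<theta> - ridge_angle d i)))" for d \<theta>
  have zero: "(\<Sum>d<2 * m. A d (direction j m) * poly (chebyshev_U d) (node m k)) = 0"
    if j: "j \<le> 2 * m" and k: "k \<in> {1..m}" for j k
  proof -
    let ?\<theta> = "direction j m" and ?\<psi> = "direction k m"
    have s: "sin ?\<psi> > 0"
      using direction_in_0_pi[OF k] by (rule sin_gt_zero)
    have rad: "radon ?\<theta> (ridge_sum (2 * m - 1) u) (node m k) = (\<Sum>d<2 * m. \<Sum>i\<le>d. u d i *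
        (2 / real (d + 1) * (poly (chebyshev_U d) (node m k) * sin ?\<psi>) *
          poly (chebyshev_U d) (cos (?\<theta> - ridge_angle d i))))" for u
    proof -
      have "{..2 * m - 1} = {..<2 * m}" using m by auto
      then show ?thesis
        unfolding node_eq_cos radon_ridge_sum[OF less_imp_le[OF s]] chebyshev_U_cos_mult_sin
        by simp
    qed
    have "sin ?\<psi> * (\<Sum>d<2 * m. A d ?\<theta> * poly (chebyshev_U d) (node m k))
        = radon ?\<theta> (ridge_sum (2 * m - 1) v) (node m k)
          - radon ?\<theta> (ridge_sum (2 * m - 1) w) (node m k)"
      unfolding rad A_def sum_distrib_left sum_distrib_right sum_subtractf[symmetric]
      by (intro sum.cong refl) (simp only: algebra_simps)
    then show ?thesis using data[OF j k] s by simp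
  qed
  define d' where "d' = 2 * m - 1 - d"
  have sum: "d + d' + 1 = 2 * m" using d by (simp add: d'_def)
  have AA: "A d (direction j m) = A d' (direction j m)" if "j \<le> 2 * m" for j
    using chebyshev_U_node_kernel[of m "\<lambda>d. A d (direction j m)" d] zero[OF that] d
    unfolding d'_def by blast
  obtain p q where
    "degree p \<le> d" "\<And>\<theta>. complex_of_real (A d \<theta>) * cis \<theta> ^ d = poly p (cis (2 * \<theta>))"
    "degree q \<le> d'" "\<And>\<theta>. complex_of_real (A d' \<theta>) * cis \<theta> ^ d' = poly q (cis (2 * \<theta>))"
    using chebyshev_U_sum_cis_poly[of d "\<lambda>i. 2 / real (d + 1) * (v d i - w d i)" "ridge_angle d" "{..d}"]
      chebyshev_U_sum_cis_poly[of d' "\<lambda>i. 2 / real (d' + 1) * (v d' i - w d' i)" "ridge_angle d'" "{..d'}"]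
    unfolding A_def by blast
  then have "A d (ridge_angle d i) = 0"
    using complementary_trig_vanish[of p d q d' m "A d" "A d'"] sum AA by blast
  \<comment> \<open>At this angle only the summand with index \<open>i\<close> survives.\<close>
  also have "A d (ridge_angle d i)
      = (\<Sum>l\<le>d. if l = i then 2 / real (d + 1) * (v d i - w d i) * real (d + 1) else 0)"
    unfolding A_def using i by (intro sum.cong) (auto simp: chebyshev_U_ridge_angle_diff)
  finally show ?thesis using i by (simp del: of_nat_Suc of_nat_add)
qed

theorem theorem2p12:
  fixes m :: nat
  assumes "m \<ge> 1"
  shows "(\<forall>j\<in>{1..m}. invertible_mat (Xi m j (node m))) \<and>
    (\<forall>P\<in>poly2_space (2 * m - 1). \<forall>Q\<in>poly2_space (2 * m - 1).
       (\<forall>j\<in>{0..2 * m}. \<forall>k\<in>{1..m}.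
          radon (direction j m) P (node m k) = radon (direction j m) Q (node m k))
       \<longrightarrow> P = Q)"
proof (intro conjI ballI impI)
  show "invertible_mat (Xi m j (node m))" if "j \<in> {1..m}" for j
    using that by (rule invertible_Xi)
next
  fix P Q
  assume "P \<in> poly2_space (2 * m - 1)" "Q \<in> poly2_space (2 * m - 1)"
  then obtain v w where PQ: "P = ridge_sum (2 * m - 1) v" "Q = ridge_sum (2 * m - 1) w"
    using poly2_space_subset_ridge_space[of "2 * m - 1"] unfolding ridge_space_def by blast
  assume "\<forall>j\<in>{0..2 * m}. \<forall>k\<in>{1..m}.
    radon (direction j m) P (node m k) = radon (direction j m) Q (node m k)"
  then have "v d i = w d i" if "d \<le> 2 * m - 1" "i \<le> d" for d i
    using radon_ridge_sum_data_injective[OF assms, of v w d i] that assms unfolding PQ by simp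
  then show "P = Q"
    unfolding PQ ridge_sum_def fun_eq_iff by simp
qed

end
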